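(* Let $L$ be a lattice with $(q-1)L_\beta\subseteq L\subseteq L_\beta$. Then the subgroups $V_{X(\mathbb K)}(I_L)$ and $V_{X(\mathbb F_q)}(I_L)$ are the same, for any field $\mathbb K$ which is an extension of $\mathbb F_q$.
   Context: $\mathbb F_q$ is a finite field, $\mathbb K$ is an extension field of $\mathbb F_q$ with algebraic closure $\overline{\mathbb K}$. $\Sigma$ is a complete simplicial fan in $\mathbb R^n$ with rays $\rho_1,\dots,\rho_r$ generated by primitive lattice vectors $\mathbf v_1,\dots,\mathbf v_r\in\mathbb Z^n$, and $X=X_\Sigma$ is the corresponding split toric variety over $\mathbb F_q$; its class group $\operatorname{Cl}X$ is assumed to be free. Let $\phi:\mathbb Z^n\to\mathbb Z^r$ be the $r\times n$ matrix with rows $\mathbf v_1,\dots,\mathbf v_r$, let $d=r-n$, and let $\beta:\mathbb Z^r\to\mathbb Z^d\cong \operatorname{Cl}X$ be an integer matrix such that $0\to\mathbb Z^n\xrightarrow{\phi}\mathbb Z^r\xrightarrow{\beta}\mathbb Z^d\to0$ is exact. $L_\beta=\operatorname{im}\phi=\ker\beta\subseteq\mathbb Z^r$, a lattice of rank $n$. The Cox ring $S=\mathbb F_q[x_1,\dots,x_r]$ is graded by $\deg x_j=\beta_j$, the $j$-th column of $\beta$; "homogeneous" refers to this grading. For a sublattice $L\subseteq L_\beta$, the lattice ideal is $I_L=\langle \mathbf x^{\mathbf m^+}-\mathbf x^{\mathbf m^-} : \mathbf m=\mathbf m^+-\mathbf m^-\in L\rangle$, where $\mathbf m^{\pm}\in\mathbb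 N^r$ are the positive and negative parts of $\mathbf m$. $B$ is the monomial ideal generated by $\prod_{\rho_i\not\subseteq\sigma}x_i$, $\sigma\in\Sigma$. $G=\{P\in(\overline{\mathbb K}^* )^r : \mathbf x^{\mathbf m}(P)=1 \text{ for all } \mathbf m\in L_\beta\}$, where $\mathbf x^{\mathbf a}(P)=p_1^{a_1}\cdots p_r^{a_r}$. For a field $\mathbb F\in\{\mathbb F_q,\mathbb K\}$, $X(\mathbb F)$ is the set of orbits $[P]=G\cdot P$ with $P\in\mathbb F^r\setminus V(B)$ (so $X(\mathbb F_q)\subseteq X(\mathbb K)$), and for a homogeneous ideal $J$, $V_{X(\mathbb F)}(J)=\{[P]\in X(\mathbb F): F(P)=0\text{ for all homogeneous }F\in J\}$. These sets, for $J=I_L$ with $L\subseteq L_\beta$ of rank $n$, are subgroups of the torus $T_X(\mathbb F)$ of orbits $[P]$ with $P\in(\mathbb F^* )^r$, under coordinatewise multiplication. *)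

theory Defs
  imports
    "HOL-Analysis.Analysis"
    "HOL-Library.Poly_Mapping"
    "HOL-Algebra.Algebraic_Closure_Type"
begin

unbundle no fps_syntax

section \<open>Fans\<close>

definition real_vec :: "int ^ 'n \<Rightarrow> real ^ 'n" where
  "real_vec u = (\<chi> j. real_of_int (u $ j))"

definition rational_polyhedral_cone :: "(real ^ 'n) set \<Rightarrow> bool" where
  "rational_polyhedral_cone \<sigma> \<longleftrightarrow> (\<exists>A. finite A \<and> \<sigma> = convex_cone hull (real_vec ` A))"

definition strongly_convex_cone :: "'a::real_vector set \<Rightarrow> bool" where
  "strongly_convex_cone \<sigma> \<longleftrightarrow> \<sigma> \<inter> uminus ` \<sigma> = {0}"

text \<open>The library's face relation counts the empty set as a face; for cones it is excluded.\<close>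

definition fan :: "(real ^ 'n) set set \<Rightarrow> bool" where
  "fan \<Sigma> \<longleftrightarrow> finite \<Sigma>
     \<and> (\<forall>\<sigma>\<in>\<Sigma>. rational_polyhedral_cone \<sigma> \<and> strongly_convex_cone \<sigma>)
     \<and> (\<forall>\<sigma>\<in>\<Sigma>. \<forall>\<tau>. \<tau> face_of \<sigma> \<and> \<tau> \<noteq> {} \<longrightarrow> \<tau> \<in> \<Sigma>)
     \<and> (\<forall>\<sigma>\<in>\<Sigma>. \<forall>\<tau>\<in>\<Sigma>. (\<sigma> \<inter> \<tau>) face_of \<sigma> \<and> (\<sigma> \<inter> \<tau>) face_of \<tau>)"

definition complete_fan :: "(real ^ 'n) set set \<Rightarrow> bool" where
  "complete_fan \<Sigma> \<longleftrightarrow> fan \<Sigma> \<and> \<Union>\<Sigma> = UNIV"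

definition simplicial_fan :: "(real ^ 'n) set set \<Rightarrow> bool" where
  "simplicial_fan \<Sigma> \<longleftrightarrow> fan \<Sigma> \<and> (\<forall>\<sigma>\<in>\<Sigma>. \<exists>B. independent B \<and> \<sigma> = convex_cone hull B)"

definition primitive_vec :: "int ^ 'n \<Rightarrow> bool" where
  "primitive_vec u \<longleftrightarrow> (GCD j. u $ j) = 1"

definition ray :: "int ^ 'n \<Rightarrow> (real ^ 'n) set" where
  "ray u = convex_cone hull {real_vec u}"

text \<open>The index type \<open>'r\<close> enumerates the one-dimensional cones of the fan without repetition.\<close>

definition primitive_ray_generators :: "(real ^ 'n) set set \<Rightarrow> ('r \<Rightarrow> int ^ 'n) \<Rightarrow> bool" where
  "primitive_ray_generators \<Sigma> v \<longleftrightarrow>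
     (\<forall>i. primitive_vec (v i)) \<and> bij_betw (\<lambda>i. ray (v i)) UNIV {\<rho> \<in> \<Sigma>. dim \<rho> = 1}"

section \<open>Lattices\<close>

definition lattice_in :: "(int ^ 'r) set \<Rightarrow> bool" where
  "lattice_in L \<longleftrightarrow> 0 \<in> L \<and> (\<forall>x\<in>L. \<forall>y\<in>L. x + y \<in> L) \<and> (\<forall>x\<in>L. - x \<in> L)"

definition mat_kernel :: "int ^ 'r ^ 'd \<Rightarrow> (int ^ 'r) set" where
  "mat_kernel \<beta> = {m. \<beta> *v m = 0}"

definition short_exact :: "int ^ 'n ^ 'r \<Rightarrow> int ^ 'r ^ 'd \<Rightarrow> bool" where
  "short_exact \<phi> \<beta> \<longleftrightarrow>
     inj ((*v) \<phi>) \<and> (*v) \<phi> ` UNIV = mat_kernel \<beta> \<and> surj ((*v) \<beta>)"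

section \<open>The Cox ring\<close>

type_synonym ('r, 'f) cox = "('r \<Rightarrow>\<^sub>0 nat) \<Rightarrow>\<^sub>0 'f"

definition cox_monomial :: "('r::finite \<Rightarrow> nat) \<Rightarrow> ('r, 'f::field) cox" where
  "cox_monomial a = Poly_Mapping.single (Abs_poly_mapping a) 1"

definition cox_var :: "'r::finite \<Rightarrow> ('r, 'f::field) cox" where
  "cox_var i = Poly_Mapping.single (Poly_Mapping.single i 1) 1"

definition ideal_gen :: "('r::finite, 'f::field) cox set \<Rightarrow> ('r, 'f) cox set" where
  "ideal_gen A = Modules.module.span (*) A"

definition monomial_degree :: "int ^ 'r ^ 'd \<Rightarrow> ('r::finite \<Rightarrow>\<^sub>0 nat) \<Rightarrow> int ^ 'd" where
  "monomial_degree \<beta> a = (\<Sum>j\<in>UNIV. int (Poly_Mapping.lookup a j) *s column j \<beta>)"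

definition cox_homogeneous :: "int ^ 'r ^ 'd \<Rightarrow> ('r::finite, 'f::field) cox \<Rightarrow> bool" where
  "cox_homogeneous \<beta> F \<longleftrightarrow> (\<exists>\<delta>. \<forall>a\<in>Poly_Mapping.keys F. monomial_degree \<beta> a = \<delta>)"

text \<open>Evaluation over an extension field, along the embedding \<open>e\<close> of the coefficient field.\<close>

definition cox_eval ::
    "('f::field \<Rightarrow> 'a::field) \<Rightarrow> ('r::finite, 'f) cox \<Rightarrow> 'a ^ 'r \<Rightarrow> 'a" where
  "cox_eval e F P = (\<Sum>a\<in>Poly_Mapping.keys F.
      e (Poly_Mapping.lookup F a) * (\<Prod>j\<in>UNIV. (P $ j) ^ Poly_Mapping.lookup a j))"

definition zero_locus ::
    "('f::field \<Rightarrow> 'a::field) \<Rightarrow> ('r::finite, 'f) cox set \<Rightarrow> ('a ^ 'r) set" where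
  "zero_locus e J = {P. \<forall>F\<in>J. cox_eval e F P = 0}"

text \<open>\<open>nat\<close> truncates negative integers, so the two exponents are \<open>m\<^sup>+\<close> and \<open>m\<^sup>-\<close>.\<close>

definition lattice_ideal :: "(int ^ 'r) set \<Rightarrow> ('r::finite, 'f::field) cox set" where
  "lattice_ideal L =
     ideal_gen {cox_monomial (\<lambda>i. nat (m $ i)) - cox_monomial (\<lambda>i. nat (- (m $ i))) | m. m \<in> L}"

definition irrelevant_ideal ::
    "(real ^ 'n) set set \<Rightarrow> ('r \<Rightarrow> int ^ 'n) \<Rightarrow> ('r::finite, 'f::field) cox set" where
  "irrelevant_ideal \<Sigma> v =
     ideal_gen {(\<Prod>i \<in> {i. \<not> ray (v i) \<subseteq> \<sigma>}. cox_var i) | \<sigma>. \<sigma> \<in> \<Sigma>}"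

section \<open>Rational points and subvarieties\<close>

text \<open>In this section \<open>'a\<close> is the algebraically closed field, \<open>e\<close> embeds \<open>\<bbbF>\<^sub>q\<close> into it, and
  \<open>\<F>\<close> is the subfield of \<open>'a\<close> over which points are taken.\<close>

definition laurent_eval :: "int ^ 'r \<Rightarrow> 'a::field ^ 'r::finite \<Rightarrow> 'a" where
  "laurent_eval m P = (\<Prod>i\<in>UNIV. (P $ i) powi (m $ i))"

definition quotient_group :: "int ^ 'r ^ 'd \<Rightarrow> ('a::field ^ 'r::finite) set" where
  "quotient_group \<beta> = {P. (\<forall>i. P $ i \<noteq> 0) \<and> (\<forall>m\<in>mat_kernel \<beta>. laurent_eval m P = 1)}"

definition orbit :: "int ^ 'r ^ 'd \<Rightarrow> 'a::field ^ 'r::finite \<Rightarrow> ('a ^ 'r) set" where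
  "orbit \<beta> P = {(\<chi> i. g $ i * P $ i) | g. g \<in> quotient_group \<beta>}"

definition affine_points ::
    "('f::field \<Rightarrow> 'a::field) \<Rightarrow> (real ^ 'n) set set \<Rightarrow> ('r \<Rightarrow> int ^ 'n) \<Rightarrow> 'a set
      \<Rightarrow> ('a ^ 'r::finite) set" where
  "affine_points e \<Sigma> v \<F> = {P. \<forall>i. P $ i \<in> \<F>} - zero_locus e (irrelevant_ideal \<Sigma> v)"

definition X_points ::
    "('f::field \<Rightarrow> 'a::field) \<Rightarrow> (real ^ 'n) set set \<Rightarrow> ('r \<Rightarrow> int ^ 'n) \<Rightarrow> int ^ 'r ^ 'd
      \<Rightarrow> 'a set \<Rightarrow> ('a ^ 'r::finite) set set" where
  "X_points e \<Sigma> v \<beta> \<F> = orbit \<beta> ` affine_points e \<Sigma> v \<F>"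

text \<open>Homogeneous polynomials vanish on all of an orbit or nowhere on it, so the choice of the
  representative \<open>P\<close> does not matter.\<close>

definition V_X ::
    "('f::field \<Rightarrow> 'a::field) \<Rightarrow> (real ^ 'n) set set \<Rightarrow> ('r \<Rightarrow> int ^ 'n) \<Rightarrow> int ^ 'r ^ 'd
      \<Rightarrow> 'a set \<Rightarrow> ('r, 'f) cox set \<Rightarrow> ('a ^ 'r::finite) set set" where
  "V_X e \<Sigma> v \<beta> \<F> J = {p \<in> X_points e \<Sigma> v \<beta> \<F>.
     \<exists>P \<in> affine_points e \<Sigma> v \<F>. p = orbit \<beta> P \<and>
       (\<forall>F\<in>J. cox_homogeneous \<beta> F \<longrightarrow> cox_eval e F P = 0)}"

end

theory Submission
  imports Defs
begin

text \<open>
  A point over \<open>\<bbbF>\<^sub>q\<close> is a point over \<open>\<bbbK>\<close>, so the content is that every orbit over \<open>\<bbbK>\<close> on which the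
  homogeneous elements of the lattice ideal vanish has a representative over \<open>\<bbbF>\<^sub>q\<close>. Let \<open>P\<close> represent
  such an orbit.

  First, \<open>P\<close> lies in the torus (\<open>lattice_ideal_zero_in_torus\<close>). Since \<open>P\<close> avoids the irrelevant locus,
  its zero coordinates belong to rays of one cone. That cone is strongly convex, so an integral
  functional is positive on these rays, and a multiple of it gives a vector of \<open>L\<close> whose binomial
  cannot vanish at \<open>P\<close> if some coordinate of \<open>P\<close> is zero.

  Second, on the torus the vanishing of the binomials says that \<open>m \<mapsto> x\<^sup>m(P)\<close> is trivial on \<open>L\<close>, hence
  on \<open>(q - 1) L\<^sub>\<beta>\<close>. On \<open>L\<^sub>\<beta>\<close> it therefore takes values in the \<open>(q - 1)\<close>-st roots of unity, and these
  are the nonzero elements of \<open>\<bbbF>\<^sub>q\<close> (\<open>finite_mult_closed_eq_roots_of_unity\<close>). As \<open>\<beta>\<close> is onto a free group,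
  \<open>L\<^sub>\<beta>\<close> is a direct summand of \<open>\<int>\<^sup>r\<close> (\<open>kernel_retraction\<close>), so this homomorphism extends to \<open>\<int>\<^sup>r\<close> with
  values in \<open>\<bbbF>\<^sub>q\<close>. The extension is evaluation at a point \<open>Q\<close> over \<open>\<bbbF>\<^sub>q\<close>, and \<open>Q\<close> is in the orbit of \<open>P\<close>
  because all \<open>x\<^sup>m\<close> with \<open>m \<in> L\<^sub>\<beta>\<close> agree at \<open>P\<close> and \<open>Q\<close> (\<open>torus_orbit_descends\<close>).
\<close>

no_notation fps_nth (infixl "$" 75)

section \<open>Finite groups of roots of unity\<close>

text \<open>Multiplication by an element permutes \<open>S\<close>, so Lagrange's argument makes the elements of \<open>S\<close>
  roots of \<open>X ^ card S - 1\<close>, and this polynomial has no room for further roots. For \<open>S\<close> the nonzero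
  elements of \<open>\<bbbF>\<^sub>q\<close> this recognises \<open>\<bbbF>\<^sub>q\<close> inside any larger field.\<close>

lemma finite_mult_closed_eq_roots_of_unity:
  fixes S :: "'a::field set"
  assumes fin: "finite S" and ne: "S \<noteq> {}" and nz: "0 \<notin> S"
    and closed: "\<And>x y. x \<in> S \<Longrightarrow> y \<in> S \<Longrightarrow> x * y \<in> S"
  shows "{x. x ^ card S = 1} = S"
proof -
  have root: "x ^ card S = 1" if x: "x \<in> S" for x
  proof -
    have inj: "inj_on ((*) x) S"
      using x nz by (auto simp: inj_on_def)
    have "(*) x ` S = S"
      using closed[OF x] by (intro endo_inj_surj fin inj) auto
    then have "\<Prod>S = (\<Prod>y\<in>S. x * y)"
      using prod.reindex[OF inj, of "\<lambda>y. y"] by simp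
    also have "\<dots> = x ^ card S * \<Prod>S"
      by (simp add: prod.distrib)
    finally show ?thesis
      using fin nz by (auto simp: prod_zero_iff)
  qed
  let ?p = "Polynomial.monom 1 (card S) - 1 :: 'a poly"
  have pos: "card S > 0"
    using fin ne by (simp add: card_gt_0_iff)
  have roots: "{x. poly ?p x = 0} = {x :: 'a. x ^ card S = 1}"
    by (simp add: poly_monom)
  have "Polynomial.coeff ?p (card S) = 1"
    using pos by simp
  then have p: "?p \<noteq> 0"
    by (metis Polynomial.coeff_0 zero_neq_one)
  have "Polynomial.degree ?p \<le> card S"
    by (intro degree_diff_le) (auto simp: degree_monom_le)
  then have "card {x :: 'a. x ^ card S = 1} \<le> card S"
    using card_poly_roots_bound[OF p] roots by simp
  moreover have "finite {x :: 'a. x ^ card S = 1}"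
    using poly_roots_finite[OF p] roots by simp
  moreover have "S \<subseteq> {x :: 'a. x ^ card S = 1}"
    using root by auto
  ultimately show ?thesis
    by (metis card_seteq)
qed

section \<open>Evaluation of Cox polynomials\<close>

lemma poly_mapping_eq_sum_single:
  fixes F :: "'x \<Rightarrow>\<^sub>0 'y::comm_monoid_add"
  shows "F = (\<Sum>a\<in>Poly_Mapping.keys F. Poly_Mapping.single a (Poly_Mapping.lookup F a))"
  by (rule poly_mapping_eqI)
    (auto simp: lookup_sum lookup_single when_def in_keys_iff sum.delta)

locale field_embedding =
  fixes e :: "'f::field \<Rightarrow> 'a::field"
  assumes add: "e (x + y) = e x + e y"
    and mult: "e (x * y) = e x * e y"
    and one: "e 1 = 1"
begin

lemma zero: "e 0 = 0"
  using add[of 0 0] by (metis add_0 add_cancel_right_left)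

lemma uminus: "e (- x) = - e x"
  using add[of x "- x"] zero by (simp add: add_eq_0_iff2)

lemma eq_0_iff: "e x = 0 \<longleftrightarrow> x = 0"
proof
  assume "e x = 0"
  show "x = 0"
  proof (rule ccontr)
    assume "x \<noteq> 0"
    then have "e x * e (inverse x) = 1"
      by (simp flip: mult add: one)
    with \<open>e x = 0\<close> show False
      by simp
  qed
qed (simp add: zero)

lemma inj: "inj e"
proof (rule injI)
  fix x y
  assume "e x = e y"
  then have "e (x - y) = 0"
    using add[of x "- y"] by (simp add: uminus)
  then show "x = y"
    by (simp add: eq_0_iff)
qed

lemma cox_eval_superset:
  assumes "finite A" and "Poly_Mapping.keys F \<subseteq> A"
  shows "cox_eval e F P =
    (\<Sum>a\<in>A. e (Poly_Mapping.lookup F a) * (\<Prod>j\<in>UNIV. (P $ j) ^ Poly_Mapping.lookup a j))"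
  unfolding cox_eval_def using assms
  by (intro sum.mono_neutral_left) (auto simp: in_keys_iff zero)

lemma cox_eval_add: "cox_eval e (F + G) P = cox_eval e F P + cox_eval e G P"
proof -
  let ?A = "Poly_Mapping.keys F \<union> Poly_Mapping.keys G"
  have "Poly_Mapping.keys (F + G) \<subseteq> ?A"
    by (rule keys_add)
  then show ?thesis
    by (simp add: cox_eval_superset[of ?A] lookup_add add sum.distrib distrib_right)
qed

lemma cox_eval_0: "cox_eval e 0 P = 0"
  by (simp add: cox_eval_def)

lemma cox_eval_diff: "cox_eval e (F - G) P = cox_eval e F P - cox_eval e G P"
  using cox_eval_add[of "F - G" G P] by simp

lemma cox_eval_sum: "cox_eval e (\<Sum>i\<in>I. F i) P = (\<Sum>i\<in>I. cox_eval e (F i) P)"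
  by (induction I rule: infinite_finite_induct) (auto simp: cox_eval_0 cox_eval_add)

lemma cox_eval_single:
  "cox_eval e (Poly_Mapping.single a c) P = e c * (\<Prod>j\<in>UNIV. (P $ j) ^ Poly_Mapping.lookup a j)"
  by (cases "c = 0") (simp_all add: cox_eval_def zero)

lemma cox_eval_mult: "cox_eval e (F * G) P = cox_eval e F P * cox_eval e G P"
proof -
  let ?s = "\<lambda>F a. Poly_Mapping.single a (Poly_Mapping.lookup F a)"
  have single: "cox_eval e (?s F a * ?s G b) P = cox_eval e (?s F a) P * cox_eval e (?s G b) P" for a b
    by (simp add: mult_single cox_eval_single mult lookup_add power_add prod.distrib algebra_simps)
  have "F * G = (\<Sum>a\<in>Poly_Mapping.keys F. \<Sum>b\<in>Poly_Mapping.keys G. ?s F a * ?s G b)"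
    by (subst poly_mapping_eq_sum_single[of F], subst poly_mapping_eq_sum_single[of G])
      (simp add: sum_product)
  then have "cox_eval e (F * G) P = (\<Sum>a\<in>Poly_Mapping.keys F. \<Sum>b\<in>Poly_Mapping.keys G.
      cox_eval e (?s F a) P * cox_eval e (?s G b) P)"
    by (simp add: cox_eval_sum single)
  also have "\<dots> = cox_eval e F P * cox_eval e G P"
    unfolding sum_product[symmetric] cox_eval_sum[symmetric]
    by (simp flip: poly_mapping_eq_sum_single)
  finally show ?thesis .
qed

lemma cox_eval_1: "cox_eval e 1 P = 1"
  by (simp flip: single_one add: cox_eval_single one)

lemma cox_eval_prod: "cox_eval e (\<Prod>i\<in>I. F i) P = (\<Prod>i\<in>I. cox_eval e (F i) P)"
  by (induction I rule: infinite_finite_induct) (auto simp: cox_eval_1 cox_eval_mult)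

lemma cox_eval_var: "cox_eval e (cox_var i) P = P $ i"
proof -
  have "(P $ j) ^ Poly_Mapping.lookup (Poly_Mapping.single i 1) j = (if j = i then P $ i else 1)" for j
    by (auto simp: lookup_single when_def)
  then show ?thesis
    by (simp add: cox_var_def cox_eval_single one)
qed

lemma cox_eval_monomial: "cox_eval e (cox_monomial a) P = (\<Prod>j\<in>UNIV. (P $ j) ^ a j)"
  by (simp add: cox_monomial_def cox_eval_single one)

lemma cox_eval_ideal_gen:
  assumes "\<And>F. F \<in> A \<Longrightarrow> cox_eval e F P = 0" and "F \<in> ideal_gen A"
  shows "cox_eval e F P = 0"
proof -
  interpret cox: Modules.module "(*) :: ('b::finite, 'f) cox \<Rightarrow> _"
    by unfold_locales (auto simp: algebra_simps)
  show ?thesis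
    using assms(2) unfolding ideal_gen_def
    by (induction rule: cox.span_induct_alt)
      (auto simp: cox_eval_0 cox_eval_add cox_eval_mult assms(1))
qed

end

lemma ideal_gen_base: "F \<in> A \<Longrightarrow> F \<in> ideal_gen A" for F :: "('r::finite, 'f::field) cox"
proof -
  interpret cox: Modules.module "(*) :: ('r, 'f) cox \<Rightarrow> _"
    by unfold_locales (auto simp: algebra_simps)
  show "F \<in> A \<Longrightarrow> F \<in> ideal_gen A"
    unfolding ideal_gen_def by (rule cox.span_base)
qed

section \<open>Laurent monomials and orbits\<close>

lemma laurent_eval_add:
  fixes P :: "'a::field ^ 'r::finite"
  assumes "\<And>i. P $ i \<noteq> 0"
  shows "laurent_eval (m + n) P = laurent_eval m P * laurent_eval n P"
  using assms by (simp add: laurent_eval_def power_int_add prod.distrib)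

lemma laurent_eval_0: "laurent_eval 0 P = 1"
  by (simp add: laurent_eval_def)

lemma laurent_eval_scale:
  fixes P :: "'a::field ^ 'r::finite"
  shows "laurent_eval (k *s m) P = laurent_eval m P powi k"
proof -
  have prod: "(\<Prod>i\<in>I. f i) powi k = (\<Prod>i\<in>I. f i powi k)" for I and f :: "'r \<Rightarrow> 'a"
    by (induction I rule: infinite_finite_induct) (auto simp: power_int_mult_distrib)
  show ?thesis
    by (simp add: laurent_eval_def prod mult.commute[of k] power_int_mult)
qed

lemma laurent_eval_sum:
  fixes P :: "'a::field ^ 'r::finite"
  assumes "\<And>i. P $ i \<noteq> 0"
  shows "laurent_eval (\<Sum>i\<in>I. m i) P = (\<Prod>i\<in>I. laurent_eval (m i) P)"
  by (induction I rule: infinite_finite_induct) (auto simp: laurent_eval_0 laurent_eval_add assms)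

lemma laurent_eval_nonzero:
  fixes P :: "'a::field ^ 'r::finite"
  assumes "\<And>i. P $ i \<noteq> 0"
  shows "laurent_eval m P \<noteq> 0"
  using assms by (simp add: laurent_eval_def)

lemma laurent_eval_times: "laurent_eval m (\<chi> i. P $ i * Q $ i) = laurent_eval m P * laurent_eval m Q"
  by (simp add: laurent_eval_def power_int_mult_distrib prod.distrib)

lemma laurent_eval_divide: "laurent_eval m (\<chi> i. P $ i / Q $ i) = laurent_eval m P / laurent_eval m Q"
  by (simp add: laurent_eval_def power_int_divide_distrib prod_dividef)

text \<open>The quotient of \<open>P\<close> by \<open>Q\<close> lies in the group \<open>G\<close> that is divided out.\<close>

lemma orbit_eqI:
  fixes P Q :: "'a::field ^ 'r::finite"
  assumes P: "\<And>i. P $ i \<noteq> 0" and Q: "\<And>i. Q $ i \<noteq> 0"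
    and eq: "\<And>m. m \<in> mat_kernel \<beta> \<Longrightarrow> laurent_eval m P = laurent_eval m Q"
  shows "orbit \<beta> P = orbit \<beta> Q"
proof -
  have sub: "orbit \<beta> P \<subseteq> orbit \<beta> Q"
    if P: "\<And>i. P $ i \<noteq> 0" and Q: "\<And>i. Q $ i \<noteq> 0"
      and eq: "\<And>m. m \<in> mat_kernel \<beta> \<Longrightarrow> laurent_eval m P = laurent_eval m Q"
    for P Q :: "'a ^ 'r"
  proof
    fix x
    assume "x \<in> orbit \<beta> P"
    then obtain g where g: "g \<in> quotient_group \<beta>" and x: "x = (\<chi> i. g $ i * P $ i)"
      by (auto simp: orbit_def)
    define h where "h = (\<chi> i. g $ i * (\<chi> i. P $ i / Q $ i) $ i)"
    have "laurent_eval m h = 1" if "m \<in> mat_kernel \<beta>" for m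
      unfolding h_def laurent_eval_times laurent_eval_divide
      using g that eq[OF that] laurent_eval_nonzero[of Q m] Q by (simp add: quotient_group_def)
    then have "h \<in> quotient_group \<beta>"
      using g P Q by (simp add: quotient_group_def h_def)
    moreover have "x = (\<chi> i. h $ i * Q $ i)"
      using Q by (simp add: x h_def)
    ultimately show "x \<in> orbit \<beta> Q"
      by (auto simp: orbit_def)
  qed
  show ?thesis
    using sub[of P Q] sub[of Q P] assms by auto
qed

section \<open>Binomials of lattice vectors\<close>

definition lattice_binomial :: "int ^ 'r \<Rightarrow> ('r::finite, 'f::field) cox" where
  "lattice_binomial m = cox_monomial (\<lambda>i. nat (m $ i)) - cox_monomial (\<lambda>i. nat (- (m $ i)))"

lemma lattice_ideal_alt: "lattice_ideal L = ideal_gen (lattice_binomial ` L)"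
  unfolding lattice_ideal_def lattice_binomial_def by (rule arg_cong[where f = ideal_gen]) auto

text \<open>The degrees of the two monomials differ by \<open>\<beta> *v m\<close>.\<close>

lemma lattice_binomial_homogeneous:
  assumes "m \<in> mat_kernel \<beta>"
  shows "cox_homogeneous \<beta> (lattice_binomial m)"
proof -
  define a b where "a = Abs_poly_mapping (\<lambda>i. nat (m $ i))" and "b = Abs_poly_mapping (\<lambda>i. nat (- (m $ i)))"
  have "monomial_degree \<beta> a - monomial_degree \<beta> b = (\<Sum>j\<in>UNIV. m $ j *s column j \<beta>)"
    unfolding monomial_degree_def sum_subtractf[symmetric]
    by (rule sum.cong) (auto simp: a_def b_def vec_eq_iff)
  also have "\<dots> = \<beta> *v m"
    by (rule matrix_mult_sum[symmetric])
  finally have "monomial_degree \<beta> a = monomial_degree \<beta> b"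
    using assms by (simp add: mat_kernel_def)
  moreover have "Poly_Mapping.keys (lattice_binomial m) \<subseteq> {a, b}"
    unfolding lattice_binomial_def cox_monomial_def a_def[symmetric] b_def[symmetric]
    using keys_diff by fastforce
  ultimately show ?thesis
    unfolding cox_homogeneous_def by blast
qed

lemma (in field_embedding) cox_eval_lattice_binomial:
  "cox_eval e (lattice_binomial m) P =
    (\<Prod>i\<in>UNIV. (P $ i) ^ nat (m $ i)) - (\<Prod>i\<in>UNIV. (P $ i) ^ nat (- (m $ i)))"
  by (simp add: lattice_binomial_def cox_eval_diff cox_eval_monomial)

text \<open>Where no coordinate vanishes, the Laurent monomial is the quotient of the two monomials of the
  binomial.\<close>

lemma (in field_embedding) lattice_binomial_vanishes_iff:
  fixes P :: "'a ^ 'r::finite"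
  assumes "\<And>i. P $ i \<noteq> 0"
  shows "cox_eval e (lattice_binomial m) P = 0 \<longleftrightarrow> laurent_eval m P = 1"
proof -
  have "(P $ i) powi (m $ i) = (P $ i) ^ nat (m $ i) / (P $ i) ^ nat (- (m $ i))" for i
    by (auto simp: power_int_def divide_inverse power_inverse)
  then have "laurent_eval m P = (\<Prod>i\<in>UNIV. (P $ i) ^ nat (m $ i)) / (\<Prod>i\<in>UNIV. (P $ i) ^ nat (- (m $ i)))"
    by (simp add: laurent_eval_def prod_dividef)
  then show ?thesis
    using assms by (simp add: cox_eval_lattice_binomial)
qed

section \<open>Solutions in the closed toric variety lie in the torus\<close>

text \<open>If \<open>0\<close> were a convex combination of \<open>S\<close>, moving one term with a positive coefficient to the other
  side would put a nonzero vector and its negative into \<open>\<sigma>\<close>. So the compact convex hull of \<open>S\<close> can be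
  strictly separated from \<open>0\<close>.\<close>

lemma strongly_convex_cone_positive_functional:
  fixes S :: "'a::euclidean_space set"
  assumes cone: "convex_cone \<sigma>" and strong: "strongly_convex_cone \<sigma>"
    and fin: "finite S" and sub: "S \<subseteq> \<sigma>" and nz: "0 \<notin> S"
  shows "\<exists>w. \<forall>x\<in>S. w \<bullet> x > 0"
proof -
  have scale: "c *\<^sub>R x \<in> \<sigma>" if "c \<ge> 0" "x \<in> \<sigma>" for c x
    using cone that by (auto simp: convex_cone_def conic_def)
  have sums: "(\<Sum>x\<in>T. u x *\<^sub>R x) \<in> \<sigma>" if "finite T" "T \<subseteq> S" "\<And>x. x \<in> S \<Longrightarrow> u x \<ge> 0" for T and u :: "'a \<Rightarrow> real"
    using that
  proof (induction T)
    case empty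
    then show ?case
      using convex_cone_contains_0[OF cone] by simp
  next
    case (insert x T)
    then show ?case
      using sub by (auto intro!: convex_cone_add[OF cone] scale)
  qed
  have "0 \<notin> convex hull S"
  proof
    assume "0 \<in> convex hull S"
    then obtain u where u: "\<And>x. x \<in> S \<Longrightarrow> u x \<ge> 0" "sum u S = 1" "(\<Sum>x\<in>S. u x *\<^sub>R x) = 0"
      unfolding convex_hull_finite[OF fin] by auto
    then obtain x where x: "x \<in> S" "u x \<noteq> 0"
      by (metis sum.neutral zero_neq_one)
    have "(\<Sum>y\<in>S. u y *\<^sub>R y) = u x *\<^sub>R x + (\<Sum>y\<in>S - {x}. u y *\<^sub>R y)"
      using fin x by (simp add: sum.remove)
    then have "u x *\<^sub>R x = - (\<Sum>y\<in>S - {x}. u y *\<^sub>R y)"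
      using u(3) by (simp add: eq_neg_iff_add_eq_0)
    moreover have "(\<Sum>y\<in>S - {x}. u y *\<^sub>R y) \<in> \<sigma>"
      using fin u(1) by (intro sums) auto
    moreover have "u x *\<^sub>R x \<in> \<sigma>"
      using x u(1) sub by (auto intro: scale)
    ultimately have "u x *\<^sub>R x \<in> \<sigma> \<inter> uminus ` \<sigma>"
      by auto
    then have "u x *\<^sub>R x = 0"
      using strong unfolding strongly_convex_cone_def by blast
    then show False
      using x nz by (metis scaleR_eq_0_iff)
  qed
  moreover have "closed (convex hull S)"
    using fin by (intro compact_imp_closed compact_convex_hull finite_imp_compact)
  ultimately obtain w b where "0 < b" "\<forall>x\<in>convex hull S. w \<bullet> x > b"
    using separating_hyperplane_closed_0[OF convex_convex_hull] by metis
  then have "w \<bullet> x > 0" if "x \<in> S" for x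
    using hull_inc[OF that, of convex] by (meson order.strict_trans)
  then show ?thesis
    by blast
qed

text \<open>Positivity on finitely many vectors survives rounding down a large multiple \<open>N *\<^sub>R w\<close>: this
  changes \<open>N * (w \<bullet> x)\<close> by at most the sum of the absolute values of the coordinates of \<open>x\<close>.\<close>

lemma integral_positive_functional:
  fixes w :: "real ^ 'n"
  assumes fin: "finite S" and pos: "\<And>x. x \<in> S \<Longrightarrow> w \<bullet> x > 0"
  shows "\<exists>u :: int ^ 'n. \<forall>x\<in>S. real_vec u \<bullet> x > 0"
proof -
  define c where "c x = (\<Sum>j\<in>UNIV. \<bar>x $ j\<bar>)" for x :: "real ^ 'n"
  \<comment> \<open>A sum serves as an upper bound for all the quotients at once.\<close>
  define N where "N = 1 + (\<Sum>x\<in>S. c x / (w \<bullet> x))"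
  define u :: "int ^ 'n" where "u = (\<chi> j. \<lfloor>N * w $ j\<rfloor>)"
  have "real_vec u \<bullet> x > 0" if x: "x \<in> S" for x
  proof -
    have "c y / (w \<bullet> y) \<ge> 0" if "y \<in> S" for y
      using pos[OF that] by (auto simp: c_def intro!: divide_nonneg_pos sum_nonneg)
    then have "c x / (w \<bullet> x) < N"
      unfolding N_def using member_le_sum[OF x _ fin, of "\<lambda>x. c x / (w \<bullet> x)"] by force
    then have "c x < N * (w \<bullet> x)"
      using pos[OF x] by (simp add: field_simps)
    moreover have "N * (w \<bullet> x) - real_vec u \<bullet> x \<le> c x"
    proof -
      have "N * (w \<bullet> x) - real_vec u \<bullet> x = (\<Sum>j\<in>UNIV. frac (N * w $ j) * x $ j)"
        by (simp add: inner_vec_def real_vec_def u_def frac_def sum_distrib_left sum_subtractf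
            left_diff_distrib mult.assoc)
      also have "\<dots> \<le> c x"
        unfolding c_def
      proof (rule sum_mono)
        fix j
        have "frac (N * w $ j) * x $ j \<le> frac (N * w $ j) * \<bar>x $ j\<bar>"
          by (intro mult_left_mono) auto
        also have "\<dots> \<le> 1 * \<bar>x $ j\<bar>"
          by (intro mult_right_mono less_imp_le[OF frac_lt_1]) auto
        finally show "frac (N * w $ j) * x $ j \<le> \<bar>x $ j\<bar>"
          by simp
      qed
      finally show ?thesis .
    qed
    ultimately show ?thesis
      by simp
  qed
  then show ?thesis
    by blast
qed

lemma primitive_vec_nonzero: "primitive_vec u \<Longrightarrow> real_vec u \<noteq> 0"
proof
  assume "primitive_vec u" "real_vec u = 0"
  then have "u $ j = 0" for j
    by (simp add: real_vec_def vec_eq_iff)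
  with \<open>primitive_vec u\<close> show False
    by (simp add: primitive_vec_def)
qed

text \<open>Since \<open>P\<close> lies outside the irrelevant locus, the coordinates that vanish at \<open>P\<close> belong to rays of a
  single cone. An integral functional \<open>u\<close> that is positive on these rays gives a lattice vector
  \<open>m = k \<phi> u\<close>, where \<open>\<phi>\<close> has the rows \<open>v i\<close>, whose binomial has all these variables in its first
  monomial and none in its second. If there were such a variable, exactly one of the two monomials
  would vanish at \<open>P\<close>. The factor \<open>k\<close>, later \<open>q - 1\<close>, brings \<open>\<phi> u\<close> into \<open>L\<close>.\<close>

lemma (in field_embedding) lattice_ideal_zero_in_torus:
  fixes v :: "'r::finite \<Rightarrow> int ^ 'n" and P :: "'a ^ 'r"
  assumes fan: "fan \<Sigma>" and prim: "\<And>i. primitive_vec (v i)"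
    and kernel: "\<And>u. (\<chi> i. v i) *v u \<in> mat_kernel \<beta>"
    and k: "k > 0" and kL: "\<And>m. m \<in> mat_kernel \<beta> \<Longrightarrow> k *s m \<in> L" and L: "L \<subseteq> mat_kernel \<beta>"
    and P: "P \<notin> zero_locus e (irrelevant_ideal \<Sigma> v)"
    and vanish: "\<And>F. F \<in> lattice_ideal L \<Longrightarrow> cox_homogeneous \<beta> F \<Longrightarrow> cox_eval e F P = 0"
  shows "P $ i \<noteq> 0"
proof
  assume i: "P $ i = 0"
  obtain \<sigma> where \<sigma>: "\<sigma> \<in> \<Sigma>" and nonzero: "\<And>j. \<not> ray (v j) \<subseteq> \<sigma> \<Longrightarrow> P $ j \<noteq> 0"
  proof (rule ccontr)
    assume none: "\<not> thesis"
    have "cox_eval e (\<Prod>j \<in> {j. \<not> ray (v j) \<subseteq> \<sigma>}. cox_var j) P = 0" if "\<sigma> \<in> \<Sigma>" for \<sigma>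
      using none that \<open>\<And>\<sigma>. \<lbrakk>\<sigma> \<in> \<Sigma>; \<And>j. \<not> ray (v j) \<subseteq> \<sigma> \<Longrightarrow> P $ j \<noteq> 0\<rbrakk> \<Longrightarrow> thesis\<close>[OF that]
      by (auto simp: cox_eval_prod cox_eval_var)
    then have "cox_eval e F P = 0" if "F \<in> irrelevant_ideal \<Sigma> v" for F
      using that unfolding irrelevant_ideal_def by (auto intro: cox_eval_ideal_gen[rotated])
    with P show False
      by (simp add: zero_locus_def)
  qed
  define Z where "Z = {j. P $ j = 0}"
  have strong: "strongly_convex_cone \<sigma>" and "rational_polyhedral_cone \<sigma>"
    using fan \<sigma> by (auto simp: fan_def)
  then have cone: "convex_cone \<sigma>"
    by (auto simp: rational_polyhedral_cone_def convex_cone_convex_cone_hull)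
  have in_\<sigma>: "(\<lambda>j. real_vec (v j)) ` Z \<subseteq> \<sigma>"
    using nonzero hull_inc[OF singletonI, of _ convex_cone] unfolding Z_def ray_def by blast
  have nz: "0 \<notin> (\<lambda>j. real_vec (v j)) ` Z"
    using primitive_vec_nonzero[OF prim] by (metis imageE)
  have fin: "finite ((\<lambda>j. real_vec (v j)) ` Z)"
    by simp
  obtain w where "\<forall>x \<in> (\<lambda>j. real_vec (v j)) ` Z. w \<bullet> x > 0"
    using strongly_convex_cone_positive_functional[OF cone strong fin in_\<sigma> nz] by blast
  then obtain u where u: "\<forall>x \<in> (\<lambda>j. real_vec (v j)) ` Z. real_vec u \<bullet> x > 0"
    using integral_positive_functional[OF fin, of w] by blast
  define m where "m = k *s ((\<chi> i. v i) *v u)"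
  have m: "m $ j > 0" if "P $ j = 0" for j
  proof -
    have "real_vec u \<bullet> real_vec (v j) = real_of_int (((\<chi> i. v i) *v u) $ j)"
      by (simp add: inner_vec_def real_vec_def matrix_vector_mult_def mult.commute)
    moreover have "real_vec u \<bullet> real_vec (v j) > 0"
      using u that by (simp add: Z_def)
    ultimately have "((\<chi> i. v i) *v u) $ j > 0"
      by (metis of_int_0_less_iff)
    then show ?thesis
      using k by (simp only: m_def vector_smult_component mult_pos_pos)
  qed
  have "m \<in> L"
    unfolding m_def by (intro kL kernel)
  then have "cox_eval e (lattice_binomial m) P = 0"
    using L by (intro vanish lattice_binomial_homogeneous) (auto simp: lattice_ideal_alt intro: ideal_gen_base)
  moreover have "(\<Prod>j\<in>UNIV. (P $ j) ^ nat (m $ j)) = 0"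
    using m[OF i] i by (auto intro!: prod_zero bexI[of _ i])
  moreover have "(P $ j) ^ nat (- (m $ j)) \<noteq> 0" for j
    using m[of j] by (cases "P $ j = 0") auto
  then have "(\<Prod>j\<in>UNIV. (P $ j) ^ nat (- (m $ j))) \<noteq> 0"
    by simp
  ultimately show False
    by (simp add: cox_eval_lattice_binomial)
qed

section \<open>Descent to the finite field\<close>

text \<open>Lifting the basis vectors of the target of \<open>\<beta>\<close> gives a right inverse \<open>S\<close>. The endomorphism
  \<open>1 - S \<beta>\<close> then projects onto the kernel, and \<open>\<rho> i\<close> is its value on the \<open>i\<close>-th basis vector.\<close>

lemma kernel_retraction:
  fixes \<beta> :: "int ^ 'r::finite ^ 'd::finite"
  assumes "surj ((*v) \<beta>)"
  obtains \<rho> :: "'r \<Rightarrow> int ^ 'r" where "\<And>i. \<rho> i \<in> mat_kernel \<beta>"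
    and "\<And>m. m \<in> mat_kernel \<beta> \<Longrightarrow> (\<Sum>i\<in>UNIV. m $ i *s \<rho> i) = m"
proof -
  have "\<forall>k. \<exists>x. \<beta> *v x = axis k 1"
    using assms by (metis surjD)
  then obtain s where s: "\<beta> *v s k = axis k 1" for k
    by (auto dest!: choice)
  define S where "S = (\<chi> i k. s k $ i)"
  have "(\<beta> ** S) $ l $ k = (\<beta> *v s k) $ l" for l k
    by (simp add: matrix_matrix_mult_def matrix_vector_mult_def S_def)
  then have section_id: "\<beta> ** S = mat 1"
    by (simp add: s vec_eq_iff axis_def mat_def)
  define R where "R = mat 1 - S ** \<beta>"
  have R: "R *v x = x - S *v (\<beta> *v x)" for x
    by (simp add: R_def matrix_vector_mult_diff_rdistrib matrix_vector_mul_assoc)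
  have "column i R = R *v axis i 1" for i
    by (simp add: vec_eq_iff column_def matrix_vector_mult_def axis_def if_distrib cong: if_cong)
  moreover have "\<beta> *v (R *v x) = 0" for x
    by (simp add: R matrix_vector_mult_diff_distrib matrix_vector_mul_assoc matrix_mul_assoc section_id)
  ultimately have "column i R \<in> mat_kernel \<beta>" for i
    by (simp add: mat_kernel_def)
  moreover have "(\<Sum>i\<in>UNIV. m $ i *s column i R) = m" if "m \<in> mat_kernel \<beta>" for m
    using that R[of m] by (simp add: mat_kernel_def flip: matrix_mult_sum)
  ultimately show thesis
    by (rule that)
qed

text \<open>The values of \<open>m \<mapsto> laurent_eval m P\<close> on the kernel are \<open>(q - 1)\<close>-st roots of unity, that is,
  elements of \<open>\<bbbF>\<^sub>q\<close>. Precomposition with the retraction extends this homomorphism to the whole exponent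
  lattice, and the coordinates of \<open>Q\<close> are the values of the extension on the basis vectors.\<close>

lemma (in field_embedding) torus_orbit_descends:
  fixes \<beta> :: "int ^ 'r::finite ^ 'd::finite" and P :: "'a ^ 'r"
  assumes fin: "finite (UNIV :: 'f set)" and surj: "surj ((*v) \<beta>)" and P: "\<And>i. P $ i \<noteq> 0"
    and order: "\<And>m. m \<in> mat_kernel \<beta> \<Longrightarrow> laurent_eval ((int CARD('f) - 1) *s m) P = 1"
  shows "\<exists>Q. (\<forall>i. Q $ i \<in> range e - {0}) \<and> orbit \<beta> Q = orbit \<beta> P
    \<and> (\<forall>m \<in> mat_kernel \<beta>. laurent_eval m Q = laurent_eval m P)"
proof -
  obtain \<rho> where \<rho>: "\<And>i. \<rho> i \<in> mat_kernel \<beta>"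
      "\<And>m. m \<in> mat_kernel \<beta> \<Longrightarrow> (\<Sum>i\<in>UNIV. m $ i *s \<rho> i) = m"
    using kernel_retraction[OF surj] by metis
  define Q where "Q = (\<chi> i. laurent_eval (\<rho> i) P)"
  define S where "S = range e - {0}"
  have S: "S = e ` (UNIV - {0})"
    using eq_0_iff by (auto simp: S_def)
  then have card: "card S = CARD('f) - 1"
    using fin by (simp add: card_image inj_on_subset[OF inj])
  have "1 \<in> S"
    unfolding S by (intro image_eqI[of _ _ 1]) (auto simp: one)
  moreover have "x * y \<in> S" if "x \<in> S" "y \<in> S" for x y
    using that by (auto simp: S_def simp flip: mult)
  ultimately have roots: "{x. x ^ card S = 1} = S"
    using fin by (intro finite_mult_closed_eq_roots_of_unity) (auto simp: S_def)
  \<comment> \<open>The assumption on orders has an integer exponent, the roots of unity a natural one.\<close>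
  have "int (card S) = int CARD('f) - 1"
    using fin by (simp add: card of_nat_diff Suc_le_eq finite_UNIV_card_ge_0)
  then have "(Q $ i) ^ card S = 1" for i
    using order[OF \<rho>(1)[of i]] unfolding laurent_eval_scale by (simp add: Q_def flip: power_int_of_nat)
  then have Q_S: "Q $ i \<in> S" for i
    using roots by auto
  moreover have Q_eq: "laurent_eval m Q = laurent_eval m P" if "m \<in> mat_kernel \<beta>" for m
  proof -
    have "laurent_eval m Q = laurent_eval (\<Sum>i\<in>UNIV. m $ i *s \<rho> i) P"
      by (simp add: laurent_eval_sum[OF P] laurent_eval_scale Q_def laurent_eval_def[of m])
    then show ?thesis
      by (simp add: \<rho>(2)[OF that])
  qed
  moreover have "orbit \<beta> Q = orbit \<beta> P"
    using Q_S Q_eq P by (intro orbit_eqI) (auto simp: S_def)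
  ultimately show ?thesis
    unfolding S_def by blast
qed

theorem lemma5p1:
  fixes \<iota> :: "'f::{field,finite} \<Rightarrow> 'k::field"
    and \<Sigma> :: "(real ^ 'n) set set"
    and v :: "'r::finite \<Rightarrow> int ^ 'n"
    and \<phi> :: "int ^ 'n ^ 'r"
    and \<beta> :: "int ^ 'r ^ 'd"
    and L :: "(int ^ 'r) set"
  assumes "\<iota> \<in> ring_hom ring_of_type_algebra ring_of_type_algebra"
    and "complete_fan \<Sigma>"
    and "simplicial_fan \<Sigma>"
    and "primitive_ray_generators \<Sigma> v"
    and "\<phi> = (\<chi> i. v i)"
    and "CARD('d) = CARD('r) - CARD('n)"
    and "short_exact \<phi> \<beta>"
    and "lattice_in L"
    and "(\<lambda>m. (int CARD('f) - 1) *s m) ` mat_kernel \<beta> \<subseteq> L"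
    and "L \<subseteq> mat_kernel \<beta>"
  shows "V_X (to_ac \<circ> \<iota>) \<Sigma> v \<beta> (range to_ac) (lattice_ideal L)
       = V_X (to_ac \<circ> \<iota>) \<Sigma> v \<beta> (range (to_ac \<circ> \<iota>)) (lattice_ideal L)"
proof -
  let ?e = "to_ac \<circ> \<iota> :: 'f \<Rightarrow> 'k alg_closure"
  interpret field_embedding ?e
    using assms(1) by unfold_locales (auto simp: ring_hom_def ring_of_type_algebra_def)
  let ?k = "int CARD('f) - 1"
  have "card {0, 1 :: 'f} \<le> CARD('f)"
    by (intro card_mono) auto
  then have k: "?k > 0"
    by simp
  have fan: "fan \<Sigma>"
    using assms(2) by (simp add: complete_fan_def)
  have prim: "primitive_vec (v i)" for i
    using assms(4) by (simp add: primitive_ray_generators_def)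
  have kernel: "(\<chi> i. v i) *v u \<in> mat_kernel \<beta>" for u
    using assms(5,7) by (auto simp: short_exact_def)
  have surj: "surj ((*v) \<beta>)"
    using assms(7) by (simp add: short_exact_def)
  have kL: "?k *s m \<in> L" if "m \<in> mat_kernel \<beta>" for m
    using assms(9) that by auto
  show ?thesis
  proof (intro equalityI subsetI)
    fix p
    assume "p \<in> V_X ?e \<Sigma> v \<beta> (range to_ac) (lattice_ideal L)"
    then obtain P where P: "P \<notin> zero_locus ?e (irrelevant_ideal \<Sigma> v)" and p: "p = orbit \<beta> P"
      and vanish: "\<And>F. F \<in> lattice_ideal L \<Longrightarrow> cox_homogeneous \<beta> F \<Longrightarrow> cox_eval ?e F P = 0"
      by (auto simp: V_X_def affine_points_def)
    have P_torus: "P $ i \<noteq> 0" for i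
      by (rule lattice_ideal_zero_in_torus[OF fan prim kernel k kL assms(10) P vanish])
    have P_L: "laurent_eval m P = 1" if "m \<in> L" for m
      using that assms(10)
      by (subst lattice_binomial_vanishes_iff[OF P_torus, symmetric], intro vanish lattice_binomial_homogeneous)
        (auto simp: lattice_ideal_alt intro: ideal_gen_base)
    obtain Q :: "'k alg_closure ^ 'r" where Q: "\<And>i. Q $ i \<in> range ?e - {0}" and orbit: "orbit \<beta> Q = orbit \<beta> P"
      and Q_P: "\<And>m. m \<in> mat_kernel \<beta> \<Longrightarrow> laurent_eval m Q = laurent_eval m P"
      using torus_orbit_descends[OF finite surj P_torus P_L[OF kL]] by blast
    have Q_torus: "Q $ i \<noteq> 0" for i
      using Q[of i] by auto
    have "cox_eval ?e (lattice_binomial m) Q = 0" if "m \<in> L" for m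
      unfolding lattice_binomial_vanishes_iff[OF Q_torus] using that assms(10) Q_P P_L by (metis subsetD)
    then have Q_generators: "cox_eval ?e F Q = 0" if "F \<in> lattice_binomial ` L" for F
      using that by auto
    have Q_vanish: "cox_eval ?e F Q = 0" if "F \<in> lattice_ideal L" for F
      by (rule cox_eval_ideal_gen[OF Q_generators that[unfolded lattice_ideal_alt]])
    have "Q \<notin> zero_locus ?e (irrelevant_ideal \<Sigma> v)"
    proof -
      have "\<Sigma> \<noteq> {}"
        using assms(2) by (auto simp: complete_fan_def)
      then obtain \<sigma> where "\<sigma> \<in> \<Sigma>"
        by blast
      let ?F = "\<Prod>i \<in> {i. \<not> ray (v i) \<subseteq> \<sigma>}. cox_var i :: ('r, 'f) cox"
      have "?F \<in> irrelevant_ideal \<Sigma> v"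
        unfolding irrelevant_ideal_def using \<open>\<sigma> \<in> \<Sigma>\<close> by (intro ideal_gen_base) auto
      moreover have "cox_eval ?e ?F Q \<noteq> 0"
        using Q_torus by (simp add: cox_eval_prod cox_eval_var)
      ultimately show ?thesis
        by (auto simp: zero_locus_def)
    qed
    then have "Q \<in> affine_points ?e \<Sigma> v (range ?e)"
      using Q by (simp add: affine_points_def)
    then show "p \<in> V_X ?e \<Sigma> v \<beta> (range ?e) (lattice_ideal L)"
      using Q_vanish p orbit by (auto simp: V_X_def X_points_def)
  next
    fix p
    assume p: "p \<in> V_X ?e \<Sigma> v \<beta> (range ?e) (lattice_ideal L)"
    have "affine_points ?e \<Sigma> v (range ?e) \<subseteq> affine_points ?e \<Sigma> v (range to_ac)"
      by (fastforce simp: affine_points_def)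
    with p show "p \<in> V_X ?e \<Sigma> v \<beta> (range to_ac) (lattice_ideal L)"
      by (auto simp: V_X_def X_points_def)
  qed
qed

end
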